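(* Assume $0<q<1$. There is a bijective correspondence $\mathbb P\leftrightarrow\mu$ between the probability laws $\mathbb P$ of infinite $q$-exchangeable binary sequences and the probability measures $\mu$ on the closed countable set $$\Delta_q:=\{1,q,q^2,\ldots\}\cup\{0\}\subset[0,1].$$
   Context: For a random binary sequence $\varepsilon=(\varepsilon_1,\varepsilon_2,\dots)\in\{0,1\}^\infty$ with probability law $\mathbb P$, write $\mathbb P(\varepsilon_1,\dots,\varepsilon_n)$ for the probability that the sequence starts with the given word $(\varepsilon_1,\dots,\varepsilon_n)\in\{0,1\}^n$. Given $q>0$, the random sequence (or its law $\mathbb P$) is called $q$-exchangeable if $\mathbb P$ is quasi-invariant under the group of finite permutations of the coordinates, with the cocycle uniquely determined by the following condition: for every $n$, every word $(\varepsilon_1,\dots,\varepsilon_n)\in\{0,1\}^n$ and every $i=1,\dots,n-1$, $$\mathbb P(\varepsilon_1,\dots,\varepsilon_{i-1},\varepsilon_{i+1},\varepsilon_i,\varepsilon_{i+2},\dots,\varepsilon_n)=q^{\varepsilon_i-\varepsilon_{i+1}}\,\mathbb P(\varepsilon_1,\dots,\varepsilon_n).$$ In words: under an elementary transposition $(\ldots,1,0,\ldots)\to(\ldots,0,1,\ldots)$, the probability is multiplied by $q$. *)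

theory Defs
  imports "HOL-Probability.Probability" "HOL-Combinatorics.Permutations"
begin

text \<open>
  Binary sequences are functions of type \<^typ>\<open>nat \<Rightarrow> bool\<close>, with \<^const>\<open>True\<close> for the digit 1 and
  with coordinates numbered from 0, under the product sigma-algebra. Probability laws on a measurable
  space \<open>M\<close> are the elements of \<open>space (prob_algebra M)\<close>.
\<close>

abbreviation seq_space :: "(nat \<Rightarrow> bool) measure" where
  "seq_space \<equiv> PiM UNIV (\<lambda>_. count_space UNIV)"

definition cylinder :: "bool list \<Rightarrow> (nat \<Rightarrow> bool) set" where
  "cylinder w = {\<omega>. \<forall>i<length w. \<omega> i = w ! i}"

text \<open>
  The finite permutations of the coordinates are those satisfying \<^const>\<open>permutation\<close>.
  Quasi-invariance says that the image of the law under each of them is equivalent to the law.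
\<close>

definition quasi_invariant :: "(nat \<Rightarrow> bool) measure \<Rightarrow> bool" where
  "quasi_invariant P \<longleftrightarrow>
     (\<forall>\<pi>. permutation \<pi> \<longrightarrow> null_sets (distr P seq_space (\<lambda>\<omega>. \<omega> \<circ> \<pi>)) = null_sets P)"

text \<open>
  The second conjunct below prescribes the cocycle. Its exponent is an integer, so that
  replacing a factor 1,0 of a word by 0,1 multiplies the probability by \<open>q\<close>,
  and replacing 0,1 by 1,0 multiplies it by \<open>1 / q\<close>.
\<close>

definition q_exchangeable :: "real \<Rightarrow> (nat \<Rightarrow> bool) measure \<Rightarrow> bool" where
  "q_exchangeable q P \<longleftrightarrow>
     quasi_invariant P \<and>
     (\<forall>w i. Suc i < length w \<longrightarrow>
        measure P (cylinder (w[i := w ! Suc i, Suc i := w ! i])) =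
          q powi (of_bool (w ! i) - of_bool (w ! Suc i)) * measure P (cylinder w))"

definition q_exchangeable_laws :: "real \<Rightarrow> (nat \<Rightarrow> bool) measure set" where
  "q_exchangeable_laws q = {P \<in> space (prob_algebra seq_space). q_exchangeable q P}"

definition Delta :: "real \<Rightarrow> real set" where
  "Delta q = range (\<lambda>k::nat. q ^ k) \<union> {0}"

abbreviation Delta_space :: "real \<Rightarrow> real measure" where
  "Delta_space q \<equiv> restrict_space borel (Delta q)"

text \<open>
  A correspondence between probability measures on \<open>Delta q\<close> and \<open>q\<close>-exchangeable laws is understood
  as in de Finetti's theorem: to \<open>\<mu>\<close> corresponds the mixture \<open>\<integral> K x \<mu>(dx)\<close> of a family of laws \<open>K x\<close>
  indexed by \<open>Delta q\<close>. A bare bijection between the two sets would carry no information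
  beyond their cardinalities. The family is required to be weakly continuous in \<open>x\<close>; on the
  space of binary sequences this means continuity of the probability of each cylinder.
\<close>

definition mixing_family :: "real \<Rightarrow> (real \<Rightarrow> (nat \<Rightarrow> bool) measure) \<Rightarrow> bool" where
  "mixing_family q K \<longleftrightarrow>
     K \<in> Delta_space q \<rightarrow>\<^sub>M prob_algebra seq_space \<and>
     (\<forall>w. continuous_on (Delta q) (\<lambda>x. measure (K x) (cylinder w)))"

end

theory Submission
  imports Defs
begin

text \<open>
  Write \<open>X\<close> for \<open>q\<close> raised to the total number of ones of a sequence (\<open>0\<close> if there are infinitely many).
  Under a \<open>q\<close>-exchangeable law, moving \<open>j\<close> leading zeros to the far end of a word of length \<open>j + m\<close>
  costs \<open>q\<close> to the power \<open>j\<close> times the number of ones; letting \<open>m\<close> grow, \<open>P(0\<^sup>j) = E[X\<^sup>j]\<close>. Together with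
  additivity this expresses every cylinder probability as the expectation of a polynomial in \<open>X\<close>,
  which for \<open>X = q\<^sup>k\<close> is the probability of the word under the law with exactly \<open>k\<close> ones. Hence \<open>P\<close> is
  the mixture of these laws along the distribution of \<open>X\<close>. Conversely, the first two moments show
  that \<open>X\<close> has variance zero under each of them, so the mixing measure is recovered as the law of \<open>X\<close>.
\<close>

section \<open>Cylinders\<close>

lemma cylinder_Nil [simp]: "cylinder [] = UNIV"
  by (simp add: cylinder_def)

lemma sets_cylinder [measurable, simp]: "cylinder w \<in> sets seq_space"
proof -
  have "{\<omega> \<in> space seq_space. \<forall>i<length w. \<omega> i = w ! i} \<in> sets seq_space"
    by measurable
  then show ?thesis
    by (simp add: cylinder_def space_PiM)
qed

lemma cylinder_append:
  "cylinder (u @ v) = {\<omega> \<in> cylinder u. (\<lambda>i. \<omega> (length u + i)) \<in> cylinder v}"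
proof (intro set_eqI iffI)
  fix \<omega> assume \<omega>: "\<omega> \<in> cylinder (u @ v)"
  have "\<omega> (length u + i) = v ! i" if "i < length v" for i
    using \<omega> that by (force simp: cylinder_def nth_append)
  moreover have "\<omega> i = u ! i" if "i < length u" for i
    using \<omega> that by (force simp: cylinder_def nth_append)
  ultimately show "\<omega> \<in> {\<omega> \<in> cylinder u. (\<lambda>i. \<omega> (length u + i)) \<in> cylinder v}"
    by (simp add: cylinder_def)
next
  fix \<omega> assume \<omega>: "\<omega> \<in> {\<omega> \<in> cylinder u. (\<lambda>i. \<omega> (length u + i)) \<in> cylinder v}"
  have "\<omega> i = (u @ v) ! i" if "i < length (u @ v)" for i
  proof (cases "i < length u")
    case True
    then show ?thesis using \<omega> by (simp add: cylinder_def nth_append)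
  next
    case False
    then obtain j where "i = length u + j"
      by (metis le_Suc_ex linorder_not_less)
    then show ?thesis
      using \<omega> that by (simp add: cylinder_def)
  qed
  then show "\<omega> \<in> cylinder (u @ v)" by (simp add: cylinder_def)
qed

lemma cylinder_Un_disjoint:
  "cylinder w = cylinder (w @ [False]) \<union> cylinder (w @ [True])"
  "cylinder (w @ [False]) \<inter> cylinder (w @ [True]) = {}"
  by (auto simp: cylinder_append) (auto simp: cylinder_def)

lemma disjoint_family_cylinder: "disjoint_family_on (\<lambda>v. cylinder (u @ v)) {v. length v = m}"
proof (unfold disjoint_family_on_def, intro ballI impI)
  fix v v' :: "bool list" assume *: "v \<in> {v. length v = m}" "v' \<in> {v. length v = m}" "v \<noteq> v'"
  have "v = v'" if "\<omega> \<in> cylinder (u @ v)" "\<omega> \<in> cylinder (u @ v')" for \<omega>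
  proof (rule nth_equalityI)
    fix i assume "i < length v"
    then have "\<omega> (length u + i) = v ! i" "\<omega> (length u + i) = v' ! i"
      using that * by (simp_all add: cylinder_append) (simp_all add: cylinder_def)
    then show "v ! i = v' ! i" by simp
  qed (use * in simp)
  with * show "cylinder (u @ v) \<inter> cylinder (u @ v') = {}" by blast
qed

text \<open>Two cylinders are nested when one word is a prefix of the other and disjoint otherwise;
  the empty set is adjoined for the second case.\<close>

lemma Int_stable_cylinder: "Int_stable (insert {} (range cylinder))"
proof -
  have "cylinder u \<inter> cylinder v \<in> {{}, cylinder v}" if "length u \<le> length v" for u v
  proof (cases "u = take (length u) v")
    case True
    have "cylinder v \<subseteq> cylinder u"
      by (metis (no_types, lifting) True append_take_drop_id cylinder_append mem_Collect_eq subsetI)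
    then show ?thesis by auto
  next
    case False
    have "u = take (length u) v" if "\<omega> \<in> cylinder u" "\<omega> \<in> cylinder v" for \<omega>
      using that \<open>length u \<le> length v\<close>
      by (intro nth_equalityI) (auto simp: cylinder_def)
    with False show ?thesis by auto
  qed
  then have "cylinder u \<inter> cylinder v \<in> {{}, cylinder u, cylinder v}" for u v
    by (metis Int_commute insert_iff linear)
  then have "cylinder u \<inter> cylinder v \<in> insert {} (range cylinder)" for u v
    by (metis insertCI insertE rangeI singletonD)
  then show ?thesis
    unfolding Int_stable_def by auto
qed

lemma sets_seq_space: "sets seq_space = sigma_sets UNIV (insert {} (range cylinder))"
proof
  let ?G = "sigma UNIV (insert {} (range cylinder))"
  have "(\<lambda>\<omega>. \<omega>) \<in> ?G \<rightarrow>\<^sub>M seq_space"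
  proof (rule measurable_PiM_single')
    fix i :: nat
    show "(\<lambda>\<omega>. \<omega> i) \<in> ?G \<rightarrow>\<^sub>M count_space UNIV"
    proof (subst measurable_count_space_eq2, simp, safe)
      fix b :: bool
      \<comment> \<open>A condition on coordinate \<open>i\<close> is a finite union of cylinders:
        list all words of length \<open>Suc i\<close> with last digit \<open>b\<close>.\<close>
      have *: "(\<lambda>\<omega>. \<omega> i) -` {b} = (\<Union>w\<in>{w. length w = Suc i \<and> w ! i = b}. cylinder w)"
      proof (intro set_eqI iffI)
        fix \<omega> :: "nat \<Rightarrow> bool"
        assume "\<omega> \<in> (\<lambda>\<omega>. \<omega> i) -` {b}"
        then show "\<omega> \<in> (\<Union>w\<in>{w. length w = Suc i \<and> w ! i = b}. cylinder w)"
          by (intro UN_I[of "map \<omega> [0..<Suc i]"]) (auto simp: cylinder_def nth_append simp del: upt_Suc)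
      qed (auto simp: cylinder_def)
      have "(\<Union>w\<in>{w. length w = Suc i \<and> w ! i = b}. cylinder w) \<in> sets ?G"
        by (intro sets.countable_UN') auto
      then show "(\<lambda>\<omega>. \<omega> i) -` {b} \<inter> space ?G \<in> sets ?G"
        by (simp add: * space_measure_of_conv)
    qed simp
  qed (auto simp: space_measure_of_conv)
  then have "sets seq_space \<subseteq> sets ?G"
    using measurable_sets[of "\<lambda>\<omega>. \<omega>" ?G seq_space] by (auto simp: space_measure_of_conv)
  then show "sets seq_space \<subseteq> sigma_sets UNIV (insert {} (range cylinder))"
    by simp
  have "insert {} (range cylinder) \<subseteq> sets seq_space" by auto
  from sets.sigma_sets_subset[OF this]
  show "sigma_sets UNIV (insert {} (range cylinder)) \<subseteq> sets seq_space"
    by (simp add: space_PiM)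
qed

text \<open>Splitting a word by its next digit reduces short words to long ones, so agreement on
  words of length at least \<open>n\<close> suffices. The threshold lets a function of the first
  \<open>n\<close> coordinates be constant on every tested cylinder.\<close>

lemma measure_eqI_cylinder:
  assumes "finite_measure M" and M: "sets M = sets seq_space" and N: "sets N = sets seq_space"
    and eq: "\<And>w. n \<le> length w \<Longrightarrow> emeasure M (cylinder w) = emeasure N (cylinder w)"
  shows "M = N"
proof -
  have all: "emeasure M (cylinder w) = emeasure N (cylinder w)" if "n \<le> length w + d" for w d
    using that
  proof (induction d arbitrary: w)
    case 0
    then show ?case by (simp add: eq)
  next
    case (Suc d)
    have "emeasure L (cylinder w) = emeasure L (cylinder (w @ [False])) + emeasure L (cylinder (w @ [True]))"
      if "sets L = sets seq_space" for L
      using cylinder_Un_disjoint[of w] that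
      by (metis plus_emeasure sets_cylinder)
    with M N Suc show ?case by simp
  qed
  show ?thesis
  proof (rule measure_eqI_generator_eq[OF Int_stable_cylinder, where A="\<lambda>_. UNIV" and \<Omega>=UNIV])
    fix X assume "X \<in> insert {} (range cylinder)"
    then show "emeasure M X = emeasure N X"
      using all by (auto intro: le_add2)
  next
    show "emeasure M UNIV \<noteq> \<infinity>"
      using \<open>finite_measure M\<close> by (simp add: finite_measure.emeasure_finite)
  qed (use M N sets_seq_space in \<open>auto intro!: image_eqI[of _ cylinder "[]"]\<close>)
qed

section \<open>The adjacent swap rule implies quasi-invariance\<close>

text \<open>The cocycle condition by itself; quasi-invariance is derived from it in
  \<open>quasi_invariantI\<close>.\<close>

definition swap_rule :: "real \<Rightarrow> (nat \<Rightarrow> bool) measure \<Rightarrow> bool" where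
  "swap_rule q P \<longleftrightarrow>
     (\<forall>w i. Suc i < length w \<longrightarrow>
        measure P (cylinder (w[i := w ! Suc i, Suc i := w ! i])) =
          q powi (of_bool (w ! i) - of_bool (w ! Suc i)) * measure P (cylinder w))"

lemma measurable_reindex [measurable]: "(\<lambda>\<omega>. \<omega> \<circ> \<pi>) \<in> seq_space \<rightarrow>\<^sub>M seq_space"
  by (rule measurable_PiM_single') (auto simp: space_PiM)

definition null_preserving :: "(nat \<Rightarrow> bool) measure \<Rightarrow> (nat \<Rightarrow> nat) \<Rightarrow> bool" where
  "null_preserving P \<pi> \<longleftrightarrow> null_sets (distr P seq_space (\<lambda>\<omega>. \<omega> \<circ> \<pi>)) = null_sets P"

lemma null_preserving_id: "sets P = sets seq_space \<Longrightarrow> null_preserving P id"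
  by (simp add: null_preserving_def distr_id2)

text \<open>Pulling a set back along the composite means pulling it back along reindexing by
  \<open>\<tau>\<close> and then by \<open>\<sigma>\<close>; each pull-back preserves and reflects
  being null.\<close>

lemma null_preserving_comp:
  assumes P: "sets P = sets seq_space" and \<sigma>: "null_preserving P \<sigma>" and \<tau>: "null_preserving P \<tau>"
  shows "null_preserving P (\<sigma> \<circ> \<tau>)"
proof -
  have sp: "space P = UNIV"
    using sets_eq_imp_space_eq[OF P] by (simp add: space_PiM)
  have meas: "(\<lambda>\<omega>. \<omega> \<circ> \<pi>) \<in> P \<rightarrow>\<^sub>M seq_space" for \<pi>
    using measurable_reindex measurable_cong_sets[OF P refl] by blast
  have iff: "A \<in> null_sets (distr P seq_space (\<lambda>\<omega>. \<omega> \<circ> \<pi>)) \<longleftrightarrow>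
      A \<in> sets seq_space \<and> (\<lambda>\<omega>. \<omega> \<circ> \<pi>) -` A \<in> null_sets P" for A \<pi>
    using null_sets_distr_iff[OF meas[of \<pi>]] by (auto simp: sp)
  have pre: "(\<lambda>\<omega>. \<omega> \<circ> \<pi>) -` A \<in> sets seq_space" if "A \<in> sets seq_space" for A \<pi>
    using measurable_sets[OF measurable_reindex that, of \<pi>] by (simp add: space_PiM)
  have 1: "(\<lambda>\<omega>. \<omega> \<circ> \<sigma> \<circ> \<tau>) -` A = (\<lambda>\<omega>. \<omega> \<circ> \<sigma>) -` ((\<lambda>\<omega>. \<omega> \<circ> \<tau>) -` A)" for A :: "(nat \<Rightarrow> bool) set"
    by auto
  have s: "A \<in> null_sets P \<longleftrightarrow> A \<in> sets seq_space \<and> (\<lambda>\<omega>. \<omega> \<circ> \<sigma>) -` A \<in> null_sets P" for A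
    using \<sigma> iff[of A \<sigma>] by (simp add: null_preserving_def)
  have t: "A \<in> null_sets P \<longleftrightarrow> A \<in> sets seq_space \<and> (\<lambda>\<omega>. \<omega> \<circ> \<tau>) -` A \<in> null_sets P" for A
    using \<tau> iff[of A \<tau>] by (simp add: null_preserving_def)
  show ?thesis
    unfolding null_preserving_def
  proof (rule set_eqI)
    fix A
    show "A \<in> null_sets (distr P seq_space (\<lambda>\<omega>. \<omega> \<circ> (\<sigma> \<circ> \<tau>))) \<longleftrightarrow> A \<in> null_sets P"
      unfolding iff using s[of "(\<lambda>\<omega>. \<omega> \<circ> \<tau>) -` A"] t[of A] pre[of A \<tau>]
      by (auto simp: 1 comp_assoc[symmetric])
  qed
qed

text \<open>A transposition is its own inverse, so it can be moved from the sequence to the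
  word.\<close>

lemma vimage_transpose_cylinder:
  assumes "Suc i < length w"
  shows "(\<lambda>\<omega>. \<omega> \<circ> Transposition.transpose i (Suc i)) -` cylinder w = cylinder (w[i := w ! Suc i, Suc i := w ! i])"
proof (intro set_eqI)
  fix \<omega> :: "nat \<Rightarrow> bool"
  have "(\<forall>j<length w. \<omega> (Transposition.transpose i (Suc i) j) = w ! j) \<longleftrightarrow>
    (\<forall>j<length w. \<omega> j = w ! Transposition.transpose i (Suc i) j)" (is "?L \<longleftrightarrow> ?R")
  proof -
    have len: "Transposition.transpose i (Suc i) j < length w" if "j < length w" for j
      using that assms by (auto simp: Transposition.transpose_def)
    show ?thesis
      using len by (intro iffI) (metis transpose_involutory)+
  qed
  moreover have "w[i := w ! Suc i, Suc i := w ! i] ! j = w ! Transposition.transpose i (Suc i) j" if "j < length w" for j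
    using that assms by (auto simp: Transposition.transpose_def nth_list_update)
  ultimately show "\<omega> \<in> (\<lambda>\<omega>. \<omega> \<circ> Transposition.transpose i (Suc i)) -` cylinder w \<longleftrightarrow>
      \<omega> \<in> cylinder (w[i := w ! Suc i, Suc i := w ! i])"
    by (auto simp: cylinder_def)
qed

text \<open>The image law has the cocycle \<open>f\<close> as its density with respect to
  \<open>P\<close>. Since \<open>f\<close> vanishes nowhere, the null sets agree.\<close>

lemma null_preserving_adjacent:
  assumes "0 < q" and P: "prob_space P" "sets P = sets seq_space" and swap: "swap_rule q P"
  shows "null_preserving P (Transposition.transpose i (Suc i))"
proof -
  interpret prob_space P by fact
  have sp: "space P = UNIV"
    using sets_eq_imp_space_eq[OF P(2)] by (simp add: space_PiM)
  have meas: "(\<lambda>\<omega>. \<omega> \<circ> \<pi>) \<in> P \<rightarrow>\<^sub>M seq_space" for \<pi>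
    using measurable_reindex measurable_cong_sets[OF P(2) refl] by blast
  define f where "f \<omega> = ennreal (q powi (of_bool (\<omega> i) - of_bool (\<omega> (Suc i))))" for \<omega> :: "nat \<Rightarrow> bool"
  have "f \<in> borel_measurable seq_space"
    unfolding f_def of_bool_def
    by (rule measurable_compose[where g="\<lambda>(a, b). ennreal (q powi ((if a then 1 else 0) - (if b then 1 else 0)))"
        and N="count_space UNIV \<Otimes>\<^sub>M count_space UNIV" and f="\<lambda>\<omega>. (\<omega> i, \<omega> (Suc i))", simplified]) measurable
  then have f [measurable]: "f \<in> borel_measurable P"
    using measurable_cong_sets[OF P(2) refl] by blast
  have "distr P seq_space (\<lambda>\<omega>. \<omega> \<circ> Transposition.transpose i (Suc i)) = density P f"
  \<comment> \<open>Words of length at least \<open>i + 2\<close> fix both coordinates on which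
    \<open>f\<close> depends, so \<open>f\<close> is constant on their cylinders and the claim
    becomes the swap rule.\<close>
  proof (rule measure_eqI_cylinder[where n="Suc (Suc i)"])
    show "finite_measure (distr P seq_space (\<lambda>\<omega>. \<omega> \<circ> Transposition.transpose i (Suc i)))"
      using prob_space_distr[OF meas] by (rule prob_space.finite_measure)
  next
    fix w :: "bool list" assume w: "Suc (Suc i) \<le> length w"
    let ?c = "q powi (of_bool (w ! i) - of_bool (w ! Suc i))"
    have "emeasure (distr P seq_space (\<lambda>\<omega>. \<omega> \<circ> Transposition.transpose i (Suc i))) (cylinder w) =
        emeasure P (cylinder (w[i := w ! Suc i, Suc i := w ! i]))"
      using w by (subst emeasure_distr[OF meas]) (simp_all add: sp vimage_transpose_cylinder)
    also have "\<dots> = ennreal ?c * emeasure P (cylinder w)"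
      using swap w \<open>0 < q\<close> by (simp add: emeasure_eq_measure swap_rule_def ennreal_mult)
    also have "\<dots> = (\<integral>\<^sup>+\<omega>. ennreal ?c * indicator (cylinder w) \<omega> \<partial>P)"
      by (rule nn_integral_cmult_indicator[symmetric]) (simp add: P)
    also have "\<dots> = (\<integral>\<^sup>+\<omega>. f \<omega> * indicator (cylinder w) \<omega> \<partial>P)"
    proof (rule nn_integral_cong)
      fix \<omega>
      have "\<omega> i = w ! i" "\<omega> (Suc i) = w ! Suc i" if "\<omega> \<in> cylinder w"
        using that w by (auto simp: cylinder_def)
      then show "ennreal ?c * indicator (cylinder w) \<omega> = f \<omega> * indicator (cylinder w) \<omega>"
        by (auto simp: f_def split: split_indicator)
    qed
    also have "\<dots> = emeasure (density P f) (cylinder w)"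
      by (rule emeasure_density[symmetric]) (simp_all add: P f)
    finally show "emeasure (distr P seq_space (\<lambda>\<omega>. \<omega> \<circ> Transposition.transpose i (Suc i))) (cylinder w) =
      emeasure (density P f) (cylinder w)" .
  qed (simp_all add: P)
  moreover have "null_sets (density P f) = null_sets P"
  proof (rule set_eqI)
    fix A
    have "f \<omega> \<noteq> 0" for \<omega>
      using \<open>0 < q\<close> by (simp add: f_def)
    then show "A \<in> null_sets (density P f) \<longleftrightarrow> A \<in> null_sets P"
      using null_sets_density_iff[OF f, of A] AE_iff_null_sets[of A P] by auto
  qed
  ultimately show ?thesis by (simp add: null_preserving_def)
qed

text \<open>Adjacent transpositions generate all finite permutations, and preservation of null sets
  passes to compositions.\<close>

lemma quasi_invariantI:
  assumes "0 < q" and P: "prob_space P" "sets P = sets seq_space" and swap: "swap_rule q P"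
  shows "quasi_invariant P"
proof -
  have lt: "null_preserving P (Transposition.transpose a (a + Suc d))" for a d
  proof (induction d)
    case 0
    then show ?case using null_preserving_adjacent[OF assms] by simp
  next
    case (Suc d)
    let ?t = "Transposition.transpose (a + Suc d) (Suc (a + Suc d))"
    \<comment> \<open>Conjugation by an adjacent swap lengthens the reach of the transposition by
      one.\<close>
    have eq: "Transposition.transpose a (a + Suc (Suc d)) = ?t \<circ> Transposition.transpose a (a + Suc d) \<circ> ?t"
      by (auto simp: fun_eq_iff Transposition.transpose_def)
    show ?case
      unfolding eq
      by (intro null_preserving_comp[OF P(2)] Suc null_preserving_adjacent[OF assms])
  qed
  have tr: "null_preserving P (Transposition.transpose a b)" if "a \<noteq> b" for a b
  proof (cases "a < b")
    case True
    then show ?thesis using lt[of a "b - a - 1"] by simp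
  next
    case False
    then show ?thesis using that lt[of b "a - b - 1"] by (simp add: transpose_commute)
  qed
  have "null_preserving P \<pi>" if "swapidseq n \<pi>" for n \<pi>
    using that
  proof induction
    case id
    then show ?case by (rule null_preserving_id[OF P(2)])
  next
    case (comp_Suc n p a b)
    then show ?case by (intro null_preserving_comp[OF P(2)] tr)
  qed
  then show ?thesis
    unfolding quasi_invariant_def permutation_def null_preserving_def by blast
qed

lemma q_exchangeable_iff_swap_rule:
  assumes "0 < q" "prob_space P" "sets P = sets seq_space"
  shows "q_exchangeable q P \<longleftrightarrow> swap_rule q P"
  using quasi_invariantI[OF assms] by (auto simp: q_exchangeable_def swap_rule_def)

section \<open>Word probabilities under the extremal laws\<close>

text \<open>For \<open>x = q ^ k\<close> this is the probability of a word under the chain that emits 0 with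
  probability \<open>x\<close> and otherwise emits 1 and moves from \<open>x\<close> to \<open>x / q\<close>, so that \<open>k\<close> counts the ones
  still to come.\<close>

primrec word_prob :: "real \<Rightarrow> bool list \<Rightarrow> real \<Rightarrow> real" where
  "word_prob q [] x = 1"
| "word_prob q (b # w) x = (if b then (1 - x) * word_prob q w (x / q) else x * word_prob q w x)"

text \<open>\<open>word_prob\<close> is a polynomial in its last argument. A general inner function
  \<open>f\<close> is allowed because the recursion replaces \<open>x\<close> by
  \<open>x / q\<close>.\<close>

lemma continuous_word_prob [continuous_intros]:
  "q \<noteq> 0 \<Longrightarrow> continuous_on A f \<Longrightarrow> continuous_on A (\<lambda>x. word_prob q w (f x))"
proof (induction w arbitrary: f)
  case (Cons b w)
  note f = \<open>continuous_on A f\<close>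
  have fq: "continuous_on A (\<lambda>x. f x / q)"
    using f \<open>q \<noteq> 0\<close> by (intro continuous_intros) auto
  have "continuous_on A (\<lambda>x. (1 - f x) * word_prob q w (f x / q))"
    by (intro continuous_on_mult continuous_on_diff continuous_on_const f Cons.IH[OF \<open>q \<noteq> 0\<close> fq])
  moreover have "continuous_on A (\<lambda>x. f x * word_prob q w (f x))"
    by (intro continuous_on_mult f Cons.IH[OF \<open>q \<noteq> 0\<close> f])
  ultimately show ?case by (cases b) simp_all
qed simp

text \<open>Each 1 in \<open>w\<close> divides the state by \<open>q\<close>, which gives the state
  from which \<open>v\<close> starts.\<close>

lemma word_prob_append:
  assumes "q \<noteq> 0"
  shows "word_prob q (w @ v) x = word_prob q w x * word_prob q v (x / q ^ count_list w True)"
  using assms by (induction w arbitrary: x) (auto simp: mult.assoc)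

text \<open>From state \<open>x\<close> the digits 10 contribute \<open>(1 - x) * (x / q)\<close>
  and 01 contribute \<open>x * (1 - x)\<close>, and both lead to state \<open>x / q\<close>. The
  rule is thus a polynomial identity, valid for every real \<open>x\<close>.\<close>

lemma word_prob_swap:
  assumes "q \<noteq> 0" "Suc i < length w"
  shows "word_prob q (w[i := w ! Suc i, Suc i := w ! i]) x =
    q powi (of_bool (w ! i) - of_bool (w ! Suc i)) * word_prob q w x"
  using assms(2)
proof (induction w arbitrary: i x)
  case (Cons b w)
  show ?case
  proof (cases i)
    case (Suc j)
    then show ?thesis using Cons by simp
  next
    case 0
    then obtain c v where "w = c # v" using Cons.prems by (cases w) auto
    then show ?thesis
      using 0 \<open>q \<noteq> 0\<close> by (cases b; cases c) (simp_all add: power_int_minus divide_inverse)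
  qed
qed simp

section \<open>Moving zeros to the end of a word\<close>

text \<open>When the right-hand digit is 0 the exponent is 0 or 1, so the integer power turns into a
  natural one.\<close>

lemma swap_rule_adjacent:
  assumes "swap_rule q P"
  shows "measure P (cylinder (u @ b # False # v)) * q ^ of_bool b = measure P (cylinder (u @ False # b # v))"
proof -
  have "(u @ b # False # v)[length u := (u @ b # False # v) ! Suc (length u),
      Suc (length u) := (u @ b # False # v) ! length u] = u @ False # b # v"
    by (simp add: nth_append list_update_append)
  moreover have "Suc (length u) < length (u @ b # False # v)" by simp
  ultimately have "measure P (cylinder (u @ False # b # v)) =
      q powi (of_bool ((u @ b # False # v) ! length u) - of_bool ((u @ b # False # v) ! Suc (length u))) *
      measure P (cylinder (u @ b # False # v))"
    using assms unfolding swap_rule_def by metis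
  then show ?thesis by (simp add: nth_append)
qed

text \<open>The zero crosses the digits of \<open>v\<close> one at a time; each 1 accounts for one
  factor \<open>q\<close>, each 0 for none.\<close>

lemma swap_rule_move_zero:
  assumes "swap_rule q P"
  shows "measure P (cylinder (u @ False # v)) = q ^ count_list v True * measure P (cylinder (u @ v @ [False]))"
proof (induction v arbitrary: u)
  case (Cons b v)
  show ?case
    using Cons[of "u @ [b]"] swap_rule_adjacent[OF assms, of u b v] by (auto simp: algebra_simps)
qed simp

lemma swap_rule_move_zeros:
  assumes "swap_rule q P"
  shows "measure P (cylinder (replicate j False @ v)) =
    q ^ (j * count_list v True) * measure P (cylinder (v @ replicate j False))"
proof (induction j arbitrary: v)
  case (Suc j)
  \<comment> \<open>The leading zero crosses the other zeros without cost. Appending it to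
    \<open>v\<close> leaves the number of ones unchanged, so the induction hypothesis applies to
    \<open>v @ [False]\<close>.\<close>
  have "measure P (cylinder (replicate (Suc j) False @ v)) =
      q ^ count_list v True * measure P (cylinder (replicate j False @ v @ [False]))"
    using swap_rule_move_zero[OF assms, of "[]" "replicate j False @ v"]
    by simp
  also have "\<dots> = q ^ (Suc j * count_list v True) * measure P (cylinder (v @ [False] @ replicate j False))"
    using Suc[of "v @ [False]"] by (simp add: power_add)
  finally show ?case by simp
qed simp

section \<open>The number of ones and the moments\<close>

definition ones_power :: "real \<Rightarrow> (nat \<Rightarrow> bool) \<Rightarrow> real" where
  "ones_power q \<omega> = (if finite {i. \<omega> i} then q ^ card {i. \<omega> i} else 0)"

lemma ones_power_in_Delta: "ones_power q \<omega> \<in> Delta q"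
  by (auto simp: ones_power_def Delta_def)

context
  fixes q :: real
  assumes q: "0 < q" "q < 1"
begin

section \<open>The index set \<open>Delta q\<close>\<close>

lemma countable_Delta: "countable (Delta q)"
  by (simp add: Delta_def)

lemma Delta_subset: "Delta q \<subseteq> {0..1}"
  using q by (auto simp: Delta_def power_le_one)

lemma closed_Delta: "closed (Delta q)"
proof -
  have "(\<lambda>k. q ^ k) \<longlonglongrightarrow> 0"
    using q by (intro LIMSEQ_power_zero) simp
  from compact_sequence_with_limit[OF this] show ?thesis
    by (simp add: Delta_def compact_imp_closed)
qed

text \<open>All subsets of a countable set of reals are Borel, so the sigma-algebra is discrete.
  Every family of laws indexed by \<open>Delta q\<close> is therefore a measurable kernel.\<close>

lemma sets_Delta_space: "sets (Delta_space q) = Pow (Delta q)"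
proof (rule equalityI)
  show "sets (Delta_space q) \<subseteq> Pow (Delta q)"
    using sets.space_closed[of "Delta_space q"] by (simp add: space_restrict_space)
  show "Pow (Delta q) \<subseteq> sets (Delta_space q)"
  proof
    fix A assume A: "A \<in> Pow (Delta q)"
    then have "countable A" by (intro countable_subset[OF _ countable_Delta]) simp
    have "A \<in> sets borel" by (rule sets.countable[OF _ \<open>countable A\<close>]) simp
    moreover have "A = Delta q \<inter> A" using A by auto
    ultimately show "A \<in> sets (Delta_space q)" unfolding sets_restrict_space by (rule rev_image_eqI)
  qed
qed

text \<open>With finitely many ones the prefix counts become constant; with infinitely many they
  tend to infinity, and \<open>q < 1\<close> gives the limit 0, the value of
  \<open>ones_power\<close> there. Measurability of \<open>ones_power\<close> follows from this
  limit.\<close>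

lemma prefix_power_tendsto: "(\<lambda>m. q ^ card {i. i < m \<and> \<omega> i}) \<longlonglongrightarrow> ones_power q \<omega>"
proof (cases "finite {i. \<omega> i}")
  case True
  then obtain n where n: "\<And>i. \<omega> i \<Longrightarrow> i < n"
    by (auto simp: finite_nat_set_iff_bounded)
  have "{i. i < m \<and> \<omega> i} = {i. \<omega> i}" if "m \<ge> n" for m
    using n that by force
  then have "eventually (\<lambda>m. q ^ card {i. i < m \<and> \<omega> i} = ones_power q \<omega>) sequentially"
    using True unfolding eventually_sequentially ones_power_def by (intro exI[of _ n]) simp
  then show ?thesis by (rule tendsto_eventually)
next
  case False
  have "filterlim (\<lambda>m. card {i. i < m \<and> \<omega> i}) at_top sequentially"
  proof (unfold filterlim_at_top eventually_sequentially, intro allI)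
    fix t
    obtain S where S: "finite S" "card S = t" "S \<subseteq> {i. \<omega> i}"
      using infinite_arbitrarily_large[OF False] by blast
    then obtain n where n: "\<And>i. i \<in> S \<Longrightarrow> i < n"
      by (auto simp: finite_nat_set_iff_bounded)
    have "t \<le> card {i. i < m \<and> \<omega> i}" if "m \<ge> n" for m
    proof -
      have "S \<subseteq> {i. i < m \<and> \<omega> i}" using S(3) n that by force
      then show ?thesis using S(2) by (auto intro!: card_mono)
    qed
    then show "\<exists>N. \<forall>m\<ge>N. t \<le> card {i. i < m \<and> \<omega> i}" by blast
  qed
  moreover have "(\<lambda>k. q ^ k) \<longlonglongrightarrow> 0"
    using q by (intro LIMSEQ_power_zero) simp
  ultimately show ?thesis
    using False filterlim_compose[of "\<lambda>k. q ^ k" "nhds 0"] by (simp add: ones_power_def)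
qed

lemma measurable_ones_power [measurable]: "ones_power q \<in> borel_measurable seq_space"
proof (rule borel_measurable_LIMSEQ_real[OF prefix_power_tendsto])
  fix m
  \<comment> \<open>Written as a sum, the count turns the power into a finite product of functions
    of single coordinates.\<close>
  have "card {i. i < m \<and> \<omega> i} = (\<Sum>i<m. of_bool (\<omega> i))" for \<omega> :: "nat \<Rightarrow> bool"
    by (simp add: Collect_conj_eq lessThan_def of_bool_def sum.If_cases)
  then show "(\<lambda>\<omega>. q ^ card {i. i < m \<and> \<omega> i}) \<in> borel_measurable seq_space"
    by (simp only: power_sum of_bool_def) measurable
qed

lemma measurable_ones_power_Delta: "ones_power q \<in> seq_space \<rightarrow>\<^sub>M Delta_space q"
  using ones_power_in_Delta by (intro measurable_restrict_space2) auto

section \<open>Moments and cylinder probabilities as expectations\<close>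

lemma measure_cylinder_split:
  assumes "prob_space P" "sets P = sets seq_space"
  shows "measure P (cylinder w) = (\<Sum>v | length v = m. measure P (cylinder (w @ v)))"
proof -
  interpret prob_space P by fact
  have "finite {v :: bool list. length v = m}"
    using finite_lists_length_eq[of "UNIV :: bool set" m] by simp
  then have "measure P (\<Union>v\<in>{v. length v = m}. cylinder (w @ v)) = (\<Sum>v | length v = m. measure P (cylinder (w @ v)))"
    by (rule finite_measure_finite_Union) (simp_all add: image_subset_iff assms(2) disjoint_family_cylinder)
  moreover have "(\<Union>v\<in>{v. length v = m}. cylinder (w @ v)) = cylinder w"
  proof safe
    fix \<omega> assume "\<omega> \<in> cylinder w"
    then show "\<omega> \<in> (\<Union>v\<in>{v. length v = m}. cylinder (w @ v))"
      by (intro UN_I[of "map (\<lambda>i. \<omega> (length w + i)) [0..<m]"]) (simp_all add: cylinder_append, simp add: cylinder_def)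
  qed (simp add: cylinder_append)
  ultimately show ?thesis by simp
qed

text \<open>Cut the cylinder of \<open>j\<close> zeros according to the next \<open>m\<close> digits
  \<open>v\<close> and move the zeros past each \<open>v\<close>. For every \<open>m\<close> its
  probability becomes the expectation of \<open>s m\<close>, which converges boundedly to the power
  of \<open>ones_power q\<close>.\<close>

lemma swap_rule_moment:
  assumes P: "prob_space P" "sets P = sets seq_space" and swap: "swap_rule q P"
  shows "measure P (cylinder (replicate j False)) = (\<integral>\<omega>. ones_power q \<omega> ^ j \<partial>P)"
proof -
  interpret prob_space P by fact
  have cyl: "cylinder w \<in> sets P" for w by (simp add: P)
  define s where "s m \<omega> = (\<Sum>v | length v = m. q ^ (j * count_list v True) *
    indicat_real (cylinder (v @ replicate j False)) \<omega>)" for m \<omega>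
  have fin: "finite {v :: bool list. length v = m}" for m
    using finite_lists_length_eq[of "UNIV :: bool set" m] by simp
  \<comment> \<open>Only the prefix of length \<open>m\<close> contributes to the sum; the last
    factor says that the \<open>j\<close> digits after it are zero.\<close>
  have s_eq: "s m \<omega> = (q ^ card {i. i < m \<and> \<omega> i}) ^ j * of_bool (\<forall>i<j. \<not> \<omega> (m + i))" for m \<omega>
  proof -
    let ?v = "map \<omega> [0..<m]"
    have out: "\<omega> \<notin> cylinder (v @ replicate j False)" if "length v = m" "v \<noteq> ?v" for v
    proof
      assume "\<omega> \<in> cylinder (v @ replicate j False)"
      then have "\<omega> \<in> cylinder v" by (simp add: cylinder_append)
      then have "v = ?v" using that(1) by (intro nth_equalityI) (auto simp: cylinder_def)
      with that show False by simp
    qed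
    have "s m \<omega> = (\<Sum>v\<in>{?v}. q ^ (j * count_list v True) *
        indicat_real (cylinder (v @ replicate j False)) \<omega>)"
      unfolding s_def using fin out by (intro sum.mono_neutral_right) auto
    moreover have "count_list ?v True = card {i. i < m \<and> \<omega> i}"
      by (simp add: count_list_eq_length_filter filter_map o_def length_filter_conv_card
          cong: conj_cong)
    moreover have "\<omega> \<in> cylinder (?v @ replicate j False) \<longleftrightarrow> (\<forall>i<j. \<not> \<omega> (m + i))"
      by (simp add: cylinder_append) (simp add: cylinder_def)
    ultimately show ?thesis
      by (simp add: power_mult[symmetric] mult.commute indicator_def)
  qed
  have lim: "(\<lambda>m. s m \<omega>) \<longlonglongrightarrow> ones_power q \<omega> ^ j" for \<omega>
  proof (cases "finite {i. \<omega> i}")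
    case True
    then obtain n where n: "\<And>i. \<omega> i \<Longrightarrow> i < n"
      by (auto simp: finite_nat_set_iff_bounded)
    have "eventually (\<lambda>m. s m \<omega> = (q ^ card {i. i < m \<and> \<omega> i}) ^ j) sequentially"
      using eventually_ge_at_top[of n]
    proof eventually_elim
      case (elim m)
      then have "\<forall>i<j. \<not> \<omega> (m + i)" by (auto dest!: n)
      then show ?case by (simp add: s_eq)
    qed
    moreover have "(\<lambda>m. (q ^ card {i. i < m \<and> \<omega> i}) ^ j) \<longlonglongrightarrow> ones_power q \<omega> ^ j"
      by (intro tendsto_power prefix_power_tendsto)
    ultimately show ?thesis by (simp add: filterlim_cong)
  next
    case False
    \<comment> \<open>Here \<open>ones_power q\<close> is 0. The exponent \<open>j = 0\<close> is
      separate because \<open>0 ^ 0 = 1\<close>; for \<open>j > 0\<close> the prefix power bounds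
      \<open>s m\<close> and tends to 0.\<close>
    show ?thesis
    proof (cases "j = 0")
      case True
      then show ?thesis by (simp add: s_eq)
    next
      case j: False
      have "(\<lambda>m. (q ^ card {i. i < m \<and> \<omega> i}) ^ j) \<longlonglongrightarrow> 0"
        using prefix_power_tendsto[of \<omega>] False j by (simp add: ones_power_def)
      then have "(\<lambda>m. s m \<omega>) \<longlonglongrightarrow> 0"
        by (rule Lim_null_comparison[rotated]) (use q in \<open>simp add: s_eq\<close>)
      then show ?thesis using False j by (simp add: ones_power_def zero_power)
    qed
  qed
  have int: "integrable P (\<lambda>\<omega>. c * indicat_real (cylinder w) \<omega>)" for c w
    using cyl by (intro integrable_mult_right) (simp add: emeasure_eq_measure)
  have "(\<integral>\<omega>. s m \<omega> \<partial>P) = measure P (cylinder (replicate j False))" for m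
  proof -
    have "(\<integral>\<omega>. s m \<omega> \<partial>P) = (\<Sum>v | length v = m. \<integral>\<omega>. q ^ (j * count_list v True) *
        indicat_real (cylinder (v @ replicate j False)) \<omega> \<partial>P)"
      unfolding s_def by (rule Bochner_Integration.integral_sum) (rule int)
    also have "\<dots> = (\<Sum>v | length v = m. measure P (cylinder (replicate j False @ v)))"
      using cyl by (intro sum.cong) (simp_all add: swap_rule_move_zeros[OF swap])
    finally show ?thesis using measure_cylinder_split[OF P] by simp
  qed
  moreover have "(\<lambda>m. \<integral>\<omega>. s m \<omega> \<partial>P) \<longlonglongrightarrow> (\<integral>\<omega>. ones_power q \<omega> ^ j \<partial>P)"
  proof (rule integral_dominated_convergence[where w="\<lambda>_. 1"])
    show "(\<lambda>\<omega>. ones_power q \<omega> ^ j) \<in> borel_measurable P"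
      using measurable_ones_power measurable_cong_sets[OF P(2) refl] by (intro borel_measurable_power) blast
    show "s m \<in> borel_measurable P" for m
      unfolding s_def using int by (intro borel_measurable_sum borel_measurable_integrable) blast
    show "AE \<omega> in P. norm (s m \<omega>) \<le> 1" for m
      using q by (auto simp: s_eq power_mult[symmetric] power_le_one)
  qed (simp_all add: lim)
  ultimately show ?thesis
    by (simp add: LIMSEQ_const_iff)
qed

text \<open>Induction from the right, on words preceded by \<open>j\<close> zeros: a final 0 is
  moved to the front, raising \<open>j\<close> by one, and a final 1 is handled by
  additivity.\<close>

lemma swap_rule_mixture:
  assumes P: "prob_space P" "sets P = sets seq_space" and swap: "swap_rule q P"
  shows "measure P (cylinder w) = (\<integral>\<omega>. word_prob q w (ones_power q \<omega>) \<partial>P)"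
proof -
  interpret prob_space P by fact
  let ?X = "ones_power q"
  have [measurable]: "?X \<in> borel_measurable P"
    using measurable_ones_power measurable_cong_sets[OF P(2) refl] by blast
  have X: "?X \<omega> \<in> {0..1}" for \<omega>
    using ones_power_in_Delta Delta_subset by blast
  have int: "integrable P (\<lambda>\<omega>. ?X \<omega> ^ j * word_prob q w (?X \<omega>))" for j w
  proof -
    have c: "continuous_on A (\<lambda>x. x ^ j * word_prob q w x)" for A
      using q by (intro continuous_intros) auto
    have "bounded ((\<lambda>x. x ^ j * word_prob q w x) ` {0..1})"
      by (intro compact_imp_bounded compact_continuous_image c) simp
    then obtain B where "\<forall>x\<in>{0..1}. norm (x ^ j * word_prob q w x) \<le> B"
      unfolding bounded_iff by blast
    moreover have "(\<lambda>x. x ^ j * word_prob q w x) \<in> borel_measurable borel"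
      by (intro borel_measurable_continuous_onI c)
    then have "(\<lambda>\<omega>. ?X \<omega> ^ j * word_prob q w (?X \<omega>)) \<in> borel_measurable P"
      by measurable
    ultimately show ?thesis
      using X by (intro integrable_const_bound[where B=B]) auto
  qed
  have "measure P (cylinder (replicate j False @ w)) = (\<integral>\<omega>. ?X \<omega> ^ j * word_prob q w (?X \<omega>) \<partial>P)" for j
  proof (induction w arbitrary: j rule: rev_induct)
    case Nil
    then show ?case using swap_rule_moment[OF assms] by simp
  next
    case (snoc b w)
    \<comment> \<open>A final 0 multiplies \<open>word_prob\<close> by \<open>?c * X\<close>: the
      constant comes from moving the zero past \<open>w\<close>, and \<open>X\<close> raises the
      power \<open>j\<close> to \<open>Suc j\<close>.\<close>
    let ?c = "1 / q ^ count_list w True"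
    have *: "measure P (cylinder (replicate j False @ w @ [False])) =
        (\<integral>\<omega>. ?X \<omega> ^ j * word_prob q (w @ [False]) (?X \<omega>) \<partial>P)"
    proof -
      have "measure P (cylinder (replicate (Suc j) False @ w)) =
          q ^ count_list w True * measure P (cylinder (replicate j False @ w @ [False]))"
        using swap_rule_move_zero[OF swap, of "[]" "replicate j False @ w"] by simp
      then have "measure P (cylinder (replicate j False @ w @ [False])) =
          ?c * measure P (cylinder (replicate (Suc j) False @ w))"
        using q by (simp add: field_simps)
      also have "\<dots> = (\<integral>\<omega>. ?c * (?X \<omega> ^ Suc j * word_prob q w (?X \<omega>)) \<partial>P)"
        unfolding snoc by simp
      also have "\<dots> = (\<integral>\<omega>. ?X \<omega> ^ j * word_prob q (w @ [False]) (?X \<omega>) \<partial>P)"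
        using q by (intro Bochner_Integration.integral_cong) (simp_all add: word_prob_append)
      finally show ?thesis .
    qed
    show ?case
    proof (cases b)
      case False
      then show ?thesis using * by simp
    next
      case True
      \<comment> \<open>Subtracting the final-0 case from the whole leaves the factor
        \<open>1 - ?c * X\<close>, as \<open>word_prob\<close> prescribes for a final 1.\<close>
      have "measure P (cylinder (replicate j False @ w)) =
          measure P (cylinder ((replicate j False @ w) @ [False])) + measure P (cylinder ((replicate j False @ w) @ [True]))"
        by (subst cylinder_Un_disjoint(1), rule finite_measure_Union)
          (use P cylinder_Un_disjoint(2)[of "replicate j False @ w"] in simp_all)
      then have "measure P (cylinder (replicate j False @ w @ [True])) =
          (\<integral>\<omega>. ?X \<omega> ^ j * word_prob q w (?X \<omega>) \<partial>P) -
          (\<integral>\<omega>. ?X \<omega> ^ j * word_prob q (w @ [False]) (?X \<omega>) \<partial>P)"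
        using * snoc[of j] by simp
      also have "\<dots> = (\<integral>\<omega>. ?X \<omega> ^ j * word_prob q w (?X \<omega>) - ?X \<omega> ^ j * word_prob q (w @ [False]) (?X \<omega>) \<partial>P)"
        by (rule Bochner_Integration.integral_diff[symmetric]) (rule int)+
      also have "\<dots> = (\<integral>\<omega>. ?X \<omega> ^ j * word_prob q (w @ [True]) (?X \<omega>) \<partial>P)"
        using q by (intro Bochner_Integration.integral_cong) (simp_all add: word_prob_append algebra_simps)
      finally show ?thesis using True by simp
    qed
  qed
  from this[of 0] show ?thesis by simp
qed

text \<open>The swap rule is inherited from \<open>word_prob\<close>, so the moments of
  \<open>ones_power q\<close> are the powers of \<open>x\<close>. Its mean square distance from
  \<open>x\<close> is then \<open>x^2 - 2 * x^2 + x^2 = 0\<close>.\<close>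

lemma swap_rule_ones_power_AE:
  assumes P: "prob_space P" "sets P = sets seq_space"
    and w: "\<And>w. measure P (cylinder w) = word_prob q w x"
  shows "AE \<omega> in P. ones_power q \<omega> = x"
proof -
  interpret prob_space P by fact
  let ?X = "ones_power q"
  have X_meas [measurable]: "?X \<in> borel_measurable P"
    using measurable_ones_power measurable_cong_sets[OF P(2) refl] by blast
  have X: "?X \<omega> \<in> {0..1}" for \<omega>
    using ones_power_in_Delta Delta_subset by blast
  have swap: "swap_rule q P"
    using q by (auto simp: swap_rule_def w word_prob_swap)
  have pow: "word_prob q (replicate j False) x = x ^ j" for j
    by (induction j) auto
  have mom: "(\<integral>\<omega>. ?X \<omega> ^ j \<partial>P) = x ^ j" for j
    using swap_rule_moment[OF P swap, of j] w pow by simp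
  have int: "integrable P (\<lambda>\<omega>. ?X \<omega> ^ j)" for j
    using X by (intro integrable_const_bound[where B=1]) (auto simp: power_le_one)
  have int': "integrable P (\<lambda>\<omega>. (?X \<omega> - x)\<^sup>2)"
    using int[of 1] int[of 2] by (simp add: power2_diff)
  have "(\<integral>\<omega>. (?X \<omega> - x)\<^sup>2 \<partial>P) = 0"
    using int[of 1] int[of 2] mom[of 1] mom[of 2]
    by (simp add: power2_diff prob_space) (simp add: power2_eq_square)
  then have "AE \<omega> in P. (?X \<omega> - x)\<^sup>2 = 0"
    using integral_nonneg_eq_0_iff_AE[OF int'] by simp
  then show ?thesis by simp
qed

section \<open>The extremal laws\<close>

text \<open>Each of the \<open>k\<close> ones is preceded by a geometric number of zeros, with ratio \<open>q ^ i\<close> when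
  \<open>i\<close> ones remain.\<close>

primrec ones_pmf :: "nat \<Rightarrow> (nat \<Rightarrow> bool) pmf" where
  "ones_pmf 0 = return_pmf (\<lambda>_. False)"
| "ones_pmf (Suc k) =
    bind_pmf (geometric_pmf (1 - q ^ Suc k)) (\<lambda>g. map_pmf (\<lambda>\<omega>. (case_nat False ^^ g) (case_nat True \<omega>)) (ones_pmf k))"

text \<open>First-step decomposition: either the geometric number of zeros is 0 and a 1 is emitted,
  or a 0 is emitted and the count starts afresh.\<close>

lemma ones_pmf_unfold:
  "ones_pmf (Suc k) = bind_pmf (bernoulli_pmf (1 - q ^ Suc k))
     (\<lambda>b. if b then map_pmf (case_nat True) (ones_pmf k) else map_pmf (case_nat False) (ones_pmf (Suc k)))"
proof -
  have "1 - q ^ Suc k \<in> {0<..1}"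
    using q power_Suc_less_one[of q k] by auto
  then show ?thesis
    apply (subst ones_pmf.simps)
    apply (subst geometric_bind_pmf_unfold)
    apply (auto simp: bind_assoc_pmf bind_return_pmf map_bind_pmf bind_map_pmf pmf.map_comp o_def
        intro!: bind_pmf_cong)
    done
qed

text \<open>\<open>case_nat c\<close> prepends the digit \<open>c\<close> to a sequence.\<close>

lemma vimage_case_nat_cylinder:
  "case_nat c -` cylinder (b # w) = (if b = c then cylinder w else {})"
  by (auto simp: cylinder_def less_Suc_eq_0_disj nth_Cons split: nat.splits)

text \<open>With \<open>k\<close> ones to come, the first digit is 0 with probability
  \<open>q ^ k\<close> and \<open>k\<close> stays; otherwise it is 1 and \<open>k\<close> drops by
  one. This is the recursion of \<open>word_prob\<close> at \<open>q ^ k\<close>.\<close>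

lemma measure_ones_pmf_cylinder: "measure (ones_pmf k) (cylinder w) = word_prob q w (q ^ k)"
proof (induction w arbitrary: k)
  case (Cons b w)
  show ?case
  proof (cases k)
    case 0
    \<comment> \<open>For \<open>k = 0\<close> the state is 1, and the factor \<open>1 - x\<close>
      gives a word with leading 1 the value 0, whatever the other factor at
      \<open>1 / q\<close>.\<close>
    have "(\<lambda>_. False) \<in> cylinder (b # w) \<longleftrightarrow> \<not> b \<and> (\<lambda>_. False) \<in> cylinder w"
      by (force simp: cylinder_def nth_Cons split: nat.splits)
    then show ?thesis
      using Cons[of 0] 0 by (simp add: indicator_def)
  next
    case (Suc k')
    have "q ^ Suc k' \<le> 1" using q by (intro power_le_one) auto
    moreover have "measure (bind_pmf p f) A = (\<integral>c. measure (f c) A \<partial>p)"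
      for p :: "bool pmf" and f :: "bool \<Rightarrow> (nat \<Rightarrow> bool) pmf" and A
      unfolding measure_pmf_bind
      by (rule measure_pmf.measure_bind[where N="count_space UNIV"])
        (auto simp: space_subprob_algebra prob_space_imp_subprob_space measure_pmf.prob_space_axioms)
    ultimately show ?thesis
      using q unfolding Suc
      by (subst ones_pmf_unfold) (simp add: vimage_case_nat_cylinder Cons del: ones_pmf.simps(2))
  qed
qed simp

text \<open>The measure of a pmf lives on the full power set, so it is pushed along the identity to
  the product sigma-algebra. Outside \<open>Delta q\<close> the exponent given by \<open>inv\<close>
  is unspecified, but the value is still a probability law.\<close>

definition extremal_law :: "real \<Rightarrow> (nat \<Rightarrow> bool) measure" where
  "extremal_law x =
    (if x = 0 then return seq_space (\<lambda>_. True)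
     else distr (ones_pmf (inv (\<lambda>k. q ^ k) x)) seq_space (\<lambda>\<omega>. \<omega>))"

lemma measurable_from_pmf: "(\<lambda>\<omega>. \<omega>) \<in> measure_pmf p \<rightarrow>\<^sub>M seq_space"
  by (simp add: space_PiM)

lemma extremal_law_prob: "prob_space (extremal_law x)" "sets (extremal_law x) = sets seq_space"
  using measurable_from_pmf
  by (auto simp: extremal_law_def space_PiM intro!: prob_space_return measure_pmf.prob_space_distr)

lemma measure_extremal_law_cylinder:
  assumes "x \<in> Delta q"
  shows "measure (extremal_law x) (cylinder w) = word_prob q w x"
proof (cases "x = 0")
  case True
  \<comment> \<open>The state 0 is fixed under division by \<open>q\<close>, so the chain emits ones
    forever.\<close>
  have "indicator (cylinder w) (\<lambda>_. True) = word_prob q w 0"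
  proof (induction w)
    case (Cons b w)
    have "(\<lambda>_. True) \<in> cylinder (b # w) \<longleftrightarrow> b \<and> (\<lambda>_. True) \<in> cylinder w"
      by (force simp: cylinder_def nth_Cons split: nat.splits)
    then show ?case using Cons by (auto simp: indicator_def)
  qed simp
  then show ?thesis
    using True by (simp add: extremal_law_def measure_return)
next
  case False
  then obtain k where x: "x = q ^ k" using assms by (auto simp: Delta_def)
  have "inj (\<lambda>k. q ^ k)"
    using q by (intro injI) (metis linorder_neqE_nat order_less_irrefl power_strict_decreasing)
  then have "inv (\<lambda>k. q ^ k) x = k" by (simp add: x inv_f_eq)
  then have "measure (extremal_law x) (cylinder w) = measure (ones_pmf k) (cylinder w)"
    using False by (simp add: extremal_law_def measure_distr[OF measurable_from_pmf])
  then show ?thesis by (simp add: measure_ones_pmf_cylinder x)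
qed

lemma mixing_family_extremal_law: "mixing_family q extremal_law"
  unfolding mixing_family_def
proof (intro conjI allI)
  have "Delta_space q \<rightarrow>\<^sub>M prob_algebra seq_space =
      (count_space (Delta q) \<rightarrow>\<^sub>M prob_algebra seq_space)"
    by (rule measurable_cong_sets) (simp_all add: sets_Delta_space)
  then show "extremal_law \<in> Delta_space q \<rightarrow>\<^sub>M prob_algebra seq_space"
    by (simp add: space_prob_algebra extremal_law_prob)
  fix w
  have "continuous_on (Delta q) (\<lambda>x. word_prob q w x)"
    using q by (intro continuous_word_prob continuous_on_id) auto
  then show "continuous_on (Delta q) (\<lambda>x. measure (extremal_law x) (cylinder w))"
    by (rule continuous_on_eq) (simp add: measure_extremal_law_cylinder)
qed

section \<open>The mixture map and its inverse\<close>

lemma distr_ones_power_extremal_law: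
  assumes "x \<in> Delta q"
  shows "distr (extremal_law x) (Delta_space q) (ones_power q) = return (Delta_space q) x"
proof -
  interpret prob_space "extremal_law x" by (rule extremal_law_prob)
  have ae: "AE \<omega> in extremal_law x. ones_power q \<omega> = x"
    using assms by (intro swap_rule_ones_power_AE extremal_law_prob measure_extremal_law_cylinder)
  have meas: "ones_power q \<in> extremal_law x \<rightarrow>\<^sub>M Delta_space q"
    using measurable_ones_power_Delta measurable_cong_sets[OF extremal_law_prob(2) refl] by blast
  have "distr (extremal_law x) (Delta_space q) (ones_power q) = distr (extremal_law x) (Delta_space q) (\<lambda>_. x)"
    using ae meas assms by (intro distr_cong_AE) (auto simp: space_restrict_space)
  also have "\<dots> = return (Delta_space q) x"
    using assms by (intro distr_const) (simp add: space_restrict_space)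
  finally show ?thesis .
qed

text \<open>Taking the image under \<open>ones_power q\<close> commutes with mixing and turns each
  extremal law into a point mass; mixing point masses returns \<open>\<mu>\<close>.\<close>

lemma distr_ones_power_mixture:
  assumes "\<mu> \<in> space (prob_algebra (Delta_space q))"
  shows "distr (\<mu> \<bind> extremal_law) (Delta_space q) (ones_power q) = \<mu>"
proof -
  have sets: "sets \<mu> = sets (Delta_space q)" and "prob_space \<mu>"
    using assms by (auto simp: space_prob_algebra)
  then interpret prob_space \<mu> by simp
  have space: "space \<mu> = Delta q"
    using sets_eq_imp_space_eq[OF sets] by (simp add: space_restrict_space)
  have K: "extremal_law \<in> \<mu> \<rightarrow>\<^sub>M subprob_algebra seq_space"
    using mixing_family_extremal_law measurable_prob_algebraD measurable_cong_sets[OF sets refl]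
    unfolding mixing_family_def by blast
  have "distr (\<mu> \<bind> extremal_law) (Delta_space q) (ones_power q) =
      \<mu> \<bind> (\<lambda>x. distr (extremal_law x) (Delta_space q) (ones_power q))"
    by (rule distr_bind[OF K not_empty measurable_ones_power_Delta])
  also have "\<dots> = \<mu> \<bind> return \<mu>"
    by (rule bind_cong) (simp_all add: space distr_ones_power_extremal_law return_cong[OF sets])
  finally show ?thesis by (simp add: bind_return')
qed

lemma mixture_law:
  assumes "\<mu> \<in> space (prob_algebra (Delta_space q))"
  shows "prob_space (\<mu> \<bind> extremal_law)" "sets (\<mu> \<bind> extremal_law) = sets seq_space"
    "measure (\<mu> \<bind> extremal_law) (cylinder w) = (\<integral>x. word_prob q w x \<partial>\<mu>)"
proof -
  have K: "extremal_law \<in> Delta_space q \<rightarrow>\<^sub>M prob_algebra seq_space"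
    using mixing_family_extremal_law by (simp add: mixing_family_def)
  show "prob_space (\<mu> \<bind> extremal_law)" "sets (\<mu> \<bind> extremal_law) = sets seq_space"
    using prob_space_bind'[OF assms K] sets_bind'[OF assms K] by auto
  have sets: "sets \<mu> = sets (Delta_space q)" and "prob_space \<mu>"
    using assms by (auto simp: space_prob_algebra)
  then interpret prob_space \<mu> by simp
  have space: "space \<mu> = Delta q"
    using sets_eq_imp_space_eq[OF sets] by (simp add: space_restrict_space)
  have "extremal_law \<in> \<mu> \<rightarrow>\<^sub>M subprob_algebra seq_space"
    using measurable_prob_algebraD[OF K] measurable_cong_sets[OF sets refl] by blast
  then have "measure (\<mu> \<bind> extremal_law) (cylinder w) = (\<integral>x. measure (extremal_law x) (cylinder w) \<partial>\<mu>)"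
    by (rule measure_bind) simp
  also have "\<dots> = (\<integral>x. word_prob q w x \<partial>\<mu>)"
    by (intro Bochner_Integration.integral_cong) (simp_all add: space measure_extremal_law_cylinder)
  finally show "measure (\<mu> \<bind> extremal_law) (cylinder w) = (\<integral>x. word_prob q w x \<partial>\<mu>)" .
qed

text \<open>The inverse sends \<open>P\<close> to the distribution of \<open>ones_power q\<close>
  under \<open>P\<close>.\<close>

lemma bij_betw_mixture:
  "bij_betw (\<lambda>\<mu>. \<mu> \<bind> extremal_law) (space (prob_algebra (Delta_space q))) (q_exchangeable_laws q)"
proof (rule bij_betw_byWitness[where f'="\<lambda>P. distr P (Delta_space q) (ones_power q)"])
  show "\<forall>\<mu>\<in>space (prob_algebra (Delta_space q)).
      distr (\<mu> \<bind> extremal_law) (Delta_space q) (ones_power q) = \<mu>"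
    by (simp add: distr_ones_power_mixture)
  have laws: "P \<in> q_exchangeable_laws q \<longleftrightarrow> prob_space P \<and> sets P = sets seq_space \<and> swap_rule q P" for P
    using q q_exchangeable_iff_swap_rule[of q P]
    by (auto simp: q_exchangeable_laws_def space_prob_algebra)
  have dist: "distr P (Delta_space q) (ones_power q) \<in> space (prob_algebra (Delta_space q))"
    and meas: "ones_power q \<in> P \<rightarrow>\<^sub>M Delta_space q"
    if "P \<in> q_exchangeable_laws q" for P
  proof -
    have P: "prob_space P" "sets P = sets seq_space" using that by (auto simp: laws)
    show meas: "ones_power q \<in> P \<rightarrow>\<^sub>M Delta_space q"
      using measurable_ones_power_Delta measurable_cong_sets[OF P(2) refl] by blast
    show "distr P (Delta_space q) (ones_power q) \<in> space (prob_algebra (Delta_space q))"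
      using prob_space.prob_space_distr[OF P(1) meas] by (simp add: space_prob_algebra)
  qed
  then show "(\<lambda>P. distr P (Delta_space q) (ones_power q)) ` q_exchangeable_laws q
      \<subseteq> space (prob_algebra (Delta_space q))"
    by blast
  \<comment> \<open>The swap rule is linear in the law, so it passes from \<open>word_prob\<close>
    through the integral to every mixture.\<close>
  show "(\<lambda>\<mu>. \<mu> \<bind> extremal_law) ` space (prob_algebra (Delta_space q)) \<subseteq> q_exchangeable_laws q"
    using q by (auto simp: laws mixture_law swap_rule_def word_prob_swap)
  show "\<forall>P\<in>q_exchangeable_laws q. distr P (Delta_space q) (ones_power q) \<bind> extremal_law = P"
  proof
    fix P assume P: "P \<in> q_exchangeable_laws q"
    then interpret prob_space P by (simp add: laws)
    let ?\<mu> = "distr P (Delta_space q) (ones_power q)"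
    note mix = mixture_law[OF dist[OF P]]
    show "?\<mu> \<bind> extremal_law = P"
    proof (rule measure_eqI_cylinder[where n=0])
      show "finite_measure (?\<mu> \<bind> extremal_law)"
        using mix(1) by (rule prob_space.finite_measure)
      fix w
      have "continuous_on (Delta q) (\<lambda>x. word_prob q w x)"
        using q by (intro continuous_word_prob continuous_on_id) auto
      then have "word_prob q w \<in> borel_measurable (Delta_space q)"
        by (rule borel_measurable_continuous_on_restrict)
      \<comment> \<open>Integration against the distribution of \<open>ones_power q\<close> is an
        expectation under \<open>P\<close>, where \<open>swap_rule_mixture\<close> applies.\<close>
      then have "measure (?\<mu> \<bind> extremal_law) (cylinder w) = (\<integral>\<omega>. word_prob q w (ones_power q \<omega>) \<partial>P)"
        unfolding mix(3) by (intro integral_distr meas P)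
      also have "\<dots> = measure P (cylinder w)"
        using P by (intro swap_rule_mixture[symmetric]) (auto simp: laws)
      finally show "emeasure (?\<mu> \<bind> extremal_law) (cylinder w) = emeasure P (cylinder w)"
        using finite_measure.emeasure_eq_measure[OF prob_space.finite_measure[OF mix(1)]]
        by (simp add: emeasure_eq_measure)
    qed (use P mix(2) in \<open>auto simp: laws\<close>)
  qed
qed

end

theorem theorem1p2:
  fixes q :: real
  assumes "0 < q" and "q < 1"
  shows "closed (Delta q) \<and> countable (Delta q) \<and> Delta q \<subseteq> {0..1} \<and>
    (\<exists>K. mixing_family q K \<and>
      bij_betw (\<lambda>\<mu>. \<mu> \<bind> K) (space (prob_algebra (Delta_space q))) (q_exchangeable_laws q))"
  using closed_Delta[OF assms] countable_Delta[OF assms] Delta_subset[OF assms]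
    mixing_family_extremal_law[OF assms] bij_betw_mixture[OF assms] by blast

end
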